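(* Let $\lambda>0$, $\nu\in(0,1]$, $\delta>0$, and let $N^{\nu,\delta}(t)$, $t\ge 0$, be the renewal process whose i.i.d. waiting times have probability density $$f^{\nu,\delta}(t)=\lambda^\delta t^{\delta\nu-1}E_{\nu,\delta\nu}^{\delta}(-\lambda t^\nu),\qquad t>0.$$ Then the state probabilities $p_k^{\nu,\delta}(t)=\Pr\{N^{\nu,\delta}(t)=k\}$, $k\ge 1$, satisfy the convolution-type Volterra equation of the first kind $$p_k^{\nu,\delta}(t)=\lambda^\delta\int_0^t (t-w)^{\nu\delta-1}E_{\nu,\nu\delta}^{\delta}\left(-\lambda(t-w)^\nu\right)p_{k-1}^{\nu,\delta}(w)\,\mathrm dw,\qquad t\ge 0.$$
   Context: The generalized (three-parameter) Mittag--Leffler function is $$E_{\beta,\gamma}^{\xi}(z)=\sum_{r=0}^\infty\frac{(\xi)_r}{r!\,\Gamma(\beta r+\gamma)}z^r,\qquad \beta,\gamma,\xi,z\in\mathbb C,\ \Re(\beta)>0,$$ where $(\xi)_0=1$ and $(\xi)_r=\xi(\xi+1)\cdots(\xi+r-1)$ for $r\ge 1$ is the Pochhammer symbol, and $1/\Gamma$ is taken to be $0$ at the poles of $\Gamma$. The function $f^{\nu,\delta}$ is the generalized Mittag--Leffler density; its Laplace transform is $\lambda^\delta/(s^\nu+\lambda)^\delta$. Let $\mathcal T_1,\mathcal T_2,\dots$ be i.i.d. random variables with density $f^{\nu,\delta}$, and put $T_0^{\nu,\delta}=0$, $T_m^{\nu,\delta}=\mathcal T_1+\dots+\mathcal T_m$.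 The renewal process is $N^{\nu,\delta}(t)=\max\{m\ge 0: T_m^{\nu,\delta}\le t\}$, $t\ge 0$. *)

theory Defs
  imports "HOL-Probability.Probability"
begin

text \<open>Three-parameter (Prabhakar) Mittag-Leffler function \<open>E\<^sub>\<beta>\<^sub>,\<^sub>\<gamma>\<^sup>\<xi>(z)\<close>, meant for parameters with
  \<open>Re \<beta> > 0\<close>, where the series converges for every \<open>z\<close>. The type \<open>'a\<close> covers both \<^typ>\<open>complex\<close> and
  \<^typ>\<open>real\<close>; at real arguments all terms of the complex series are real, so the real instance is
  its restriction. The function \<^const>\<open>rGamma\<close> is \<open>1 / \<Gamma>\<close>, with value \<open>0\<close> at the poles of \<open>\<Gamma>\<close>.\<close>

definition mittag_leffler3 :: "'a::Gamma \<Rightarrow> 'a \<Rightarrow> 'a \<Rightarrow> 'a \<Rightarrow> 'a" where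
  "mittag_leffler3 \<beta> \<gamma> \<xi> z =
     (\<Sum>r. pochhammer \<xi> r / fact r * rGamma (\<beta> * of_nat r + \<gamma>) * z ^ r)"

definition gml_density :: "real \<Rightarrow> real \<Rightarrow> real \<Rightarrow> real \<Rightarrow> real" where
  "gml_density lam \<nu> \<delta> t =
     (if t > 0
      then lam powr \<delta> * t powr (\<delta> * \<nu> - 1) * mittag_leffler3 \<nu> (\<delta> * \<nu>) \<delta> (- lam * t powr \<nu>)
      else 0)"

text \<open>\<^const>\<open>distributed\<close> expects a density with values in \<^typ>\<open>ennreal\<close>, and \<^const>\<open>ennreal\<close> maps
  negative reals to \<open>0\<close>. For the real function \<open>f\<close> itself, and not its positive part, to be the
  probability density, \<open>f\<close> has to be nonnegative up to a null set. The lemma below shows that the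
  definition says no more than \<open>P(X \<in> A) = \<integral>\<^sub>A f\<close> for all Borel sets \<open>A\<close>.\<close>

definition has_density :: "'b measure \<Rightarrow> ('b \<Rightarrow> real) \<Rightarrow> (real \<Rightarrow> real) \<Rightarrow> bool" where
  "has_density M X f \<longleftrightarrow>
     f \<in> borel_measurable lborel \<and> (AE x in lborel. 0 \<le> f x) \<and>
     distributed M lborel X (\<lambda>x. ennreal (f x))"

lemma (in prob_space) has_density_iff:
  "has_density M X f \<longleftrightarrow>
     random_variable borel X \<and> integrable lborel f \<and>
     (\<forall>A\<in>sets borel. \<P>(\<omega> in M. X \<omega> \<in> A) = (LINT x:A|lborel. f x))"
  (is "?L \<longleftrightarrow> ?R")
proof
  assume L: ?L
  then have f[measurable]: "f \<in> borel_measurable borel" and nn: "AE x in lborel. 0 \<le> f x"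
    and D: "distributed M lborel X (\<lambda>x. ennreal (f x))"
    by (auto simp: has_density_def)
  have X[measurable]: "X \<in> borel_measurable M"
    using distributed_measurable[OF D] by simp
  have em: "emeasure M (X -` A \<inter> space M) = (\<integral>\<^sup>+x. ennreal (indicator A x * f x) \<partial>lborel)"
    if "A \<in> sets borel" for A
    using distributed_emeasure[OF D, of A] that
    by (auto intro!: nn_integral_cong split: split_indicator)
  have ev: "{\<omega> \<in> space M. X \<omega> \<in> A} = X -` A \<inter> space M" for A
    by auto
  have int: "integrable lborel f"
  proof (rule integrableI_nonneg)
    have "(\<integral>\<^sup>+x. ennreal (f x) \<partial>lborel) = emeasure M (X -` UNIV \<inter> space M)"
      using em[of UNIV] by simp
    then show "(\<integral>\<^sup>+x. ennreal (f x) \<partial>lborel) < \<infinity>"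
      by (simp add: emeasure_space_1)
  qed (use nn in auto)
  have "\<P>(\<omega> in M. X \<omega> \<in> A) = (LINT x:A|lborel. f x)" if A: "A \<in> sets borel" for A
  proof -
    have "set_lebesgue_integral lborel A f = enn2real (\<integral>\<^sup>+x. ennreal (indicator A x * f x) \<partial>lborel)"
      unfolding set_lebesgue_integral_def real_scaleR_def
      by (rule integral_eq_nn_integral) (use nn A in \<open>auto split: split_indicator\<close>)
    then show ?thesis
      using em[OF A] by (simp add: ev measure_def)
  qed
  with X int show ?R by auto
next
  assume R: ?R
  then have X[measurable]: "X \<in> borel_measurable M" and int: "integrable lborel f"
    and P: "\<And>A. A \<in> sets borel \<Longrightarrow> \<P>(\<omega> in M. X \<omega> \<in> A) = (LINT x:A|lborel. f x)"
    by auto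
  have f[measurable]: "f \<in> borel_measurable borel"
    using int by auto
  have ev: "{\<omega> \<in> space M. X \<omega> \<in> A} = X -` A \<inter> space M" for A
    by auto
  define B where "B = {x. f x < 0}"
  have B[measurable]: "B \<in> sets borel" unfolding B_def by measurable
  have intB: "integrable lborel (\<lambda>x. indicator B x * f x)"
    using integrable_mult_indicator[of B lborel f] int by simp
  have "(\<integral>x. - (indicator B x * f x) \<partial>lborel) = - \<P>(\<omega> in M. X \<omega> \<in> B)"
    using P[OF B] by (simp add: set_lebesgue_integral_def)
  then have le: "(\<integral>x. - (indicator B x * f x) \<partial>lborel) \<le> 0"
    by simp
  have ge: "AE x in lborel. 0 \<le> - (indicator B x * f x)"
    by (auto simp: B_def split: split_indicator)
  have "(\<integral>x. - (indicator B x * f x) \<partial>lborel) = 0"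
    using le integral_nonneg_AE[OF ge] by linarith
  then have "AE x in lborel. - (indicator B x * f x) = 0"
    using integral_nonneg_eq_0_iff_AE[OF _ ge] intB by simp
  then have nn: "AE x in lborel. 0 \<le> f x"
    by eventually_elim (auto simp: B_def indicator_def split: if_splits)
  have "distr M lborel X = density lborel (\<lambda>x. ennreal (f x))"
  proof (rule measure_eqI)
    fix A assume "A \<in> sets (distr M lborel X)"
    then have A[measurable]: "A \<in> sets borel" by simp
    have intA: "integrable lborel (\<lambda>x. indicator A x * f x)"
      using integrable_mult_indicator[of A lborel f] int by simp
    have "emeasure (density lborel (\<lambda>x. ennreal (f x))) A
        = (\<integral>\<^sup>+x. ennreal (indicator A x * f x) \<partial>lborel)"
      by (auto simp: emeasure_density intro!: nn_integral_cong split: split_indicator)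
    also have "\<dots> = ennreal (\<integral>x. indicator A x * f x \<partial>lborel)"
      by (rule nn_integral_eq_integral[OF intA]) (use nn in \<open>auto split: split_indicator\<close>)
    also have "\<dots> = ennreal (\<P>(\<omega> in M. X \<omega> \<in> A))"
      using P[OF A] by (simp add: set_lebesgue_integral_def)
    also have "\<dots> = emeasure (distr M lborel X) A"
      by (simp add: emeasure_distr ev emeasure_eq_measure)
    finally show "emeasure (distr M lborel X) A = emeasure (density lborel (\<lambda>x. ennreal (f x))) A"
      by simp
  qed simp
  with nn show ?L by (simp add: has_density_def distributed_def)
qed

definition renewal_time :: "(nat \<Rightarrow> 'b \<Rightarrow> real) \<Rightarrow> nat \<Rightarrow> 'b \<Rightarrow> real" where
  "renewal_time X m \<omega> = (\<Sum>i=1..m. X i \<omega>)"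

text \<open>When waiting times are positive with a common law, the set below is finite almost surely; on
  the exceptional null set \<^const>\<open>Max\<close> returns an unspecified fixed number.\<close>

definition renewal_count :: "(nat \<Rightarrow> 'b \<Rightarrow> real) \<Rightarrow> real \<Rightarrow> 'b \<Rightarrow> nat" where
  "renewal_count X t \<omega> = Max {m. renewal_time X m \<omega> \<le> t}"

definition state_prob :: "'b measure \<Rightarrow> (nat \<Rightarrow> 'b \<Rightarrow> real) \<Rightarrow> nat \<Rightarrow> real \<Rightarrow> real" where
  "state_prob M X k t = \<P>(\<omega> in M. renewal_count X t \<omega> = k)"

end

theory Submission
  imports Defs
begin

text \<open>Almost surely \<open>N(t) = k\<close> means \<open>T\<^sub>k \<le> t < T\<^sub>k\<^sub>+\<^sub>1\<close>, so \<open>p\<^sub>k = F\<^sub>k - F\<^sub>k\<^sub>+\<^sub>1\<close> for the distribution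
  function \<open>F\<^sub>m\<close> of \<open>T\<^sub>m\<close>. Independence of \<open>T\<^sub>m\<close> and the next waiting time gives the convolution
  \<open>F\<^sub>m\<^sub>+\<^sub>1 = f * F\<^sub>m\<close>, and subtracting two consecutive instances yields \<open>p\<^sub>k = f * p\<^sub>k\<^sub>-\<^sub>1\<close>.
  That \<open>N(t)\<close> is almost surely finite follows from the Chernoff bound
  \<open>P(T\<^sub>m \<le> t) \<le> e\<^sup>t c\<^sup>m\<close> with \<open>c = E e\<^sup>-\<^sup>X < 1\<close>.\<close>

text \<open>The argument runs for an arbitrary common density vanishing off the positive half-line;
  the Mittag-Leffler density is substituted only in the final theorem.\<close>

locale renewal_process = prob_space M for M :: "'b measure" +
  fixes X :: "nat \<Rightarrow> 'b \<Rightarrow> real" and f :: "real \<Rightarrow> real"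
  assumes indep: "indep_vars (\<lambda>_. borel) X {1..}"
    and dens: "i \<ge> 1 \<Longrightarrow> has_density M (X i) f"
    and f_nonpos: "x \<le> 0 \<Longrightarrow> f x = 0"
begin

section \<open>Law and almost sure positivity of the waiting times\<close>

lemma f_measurable[measurable]: "f \<in> borel_measurable borel"
  using dens[of 1] by (simp add: has_density_def)

lemma AE_f_nonneg: "AE x in lborel. 0 \<le> f x"
  using dens[of 1] by (simp add: has_density_def)

lemma waiting_distributed: "i \<ge> 1 \<Longrightarrow> distributed M lborel (X i) (\<lambda>x. ennreal (f x))"
  using dens[of i] by (simp add: has_density_def)

lemma f_integrable: "integrable lborel f"
  using dens[of 1] by (simp add: has_density_iff)

lemma waiting_measurable: "i \<ge> 1 \<Longrightarrow> X i \<in> borel_measurable M"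
  using distributed_measurable[OF waiting_distributed] by simp

lemma waiting_distr: "i \<ge> 1 \<Longrightarrow> distr M borel (X i) = density lborel (\<lambda>x. ennreal (f x))"
  using distributed_distr_eq_density[OF waiting_distributed, of i]
  by (simp cong: distr_cong)

lemma renewal_time_measurable[measurable]: "renewal_time X m \<in> borel_measurable M"
  unfolding renewal_time_def by (intro borel_measurable_sum waiting_measurable) auto

lemma AE_waiting_pos: "AE \<omega> in M. \<forall>i\<ge>1. 0 < X i \<omega>"
proof -
  have "AE \<omega> in M. 0 < X i \<omega>" if i: "i \<ge> 1" for i
  proof -
    have "AE x in density lborel (\<lambda>x. ennreal (f x)). 0 < x"
      using f_nonpos by (subst AE_density) (auto simp flip: not_le)
    then have "AE x in distr M borel (X i). 0 < x"
      by (simp only: waiting_distr[OF i])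
    then show ?thesis
      using waiting_measurable[OF i] by (subst (asm) AE_distr_iff) auto
  qed
  then show ?thesis
    by (subst AE_all_countable) (auto simp: AE_all_countable)
qed

lemma renewal_time_0[simp]: "renewal_time X 0 \<omega> = 0"
  by (simp add: renewal_time_def)

lemma renewal_time_Suc: "renewal_time X (Suc m) \<omega> = renewal_time X m \<omega> + X (Suc m) \<omega>"
  by (simp add: renewal_time_def)

lemma renewal_time_mono:
  assumes "\<forall>i\<ge>1. 0 < X i \<omega>" and "m \<le> n"
  shows "renewal_time X m \<omega> \<le> renewal_time X n \<omega>"
  using assms(2)
proof (rule lift_Suc_mono_le[rotated])
  show "renewal_time X n \<omega> \<le> renewal_time X (Suc n) \<omega>" for n
    using assms(1) by (simp add: renewal_time_Suc less_imp_le)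
qed

section \<open>Distribution functions of the renewal times and their recursion\<close>

definition time_cdf :: "nat \<Rightarrow> real \<Rightarrow> real" where
  "time_cdf m t = \<P>(\<omega> in M. renewal_time X m \<omega> \<le> t)"

lemma time_cdf_eq: "time_cdf m t = measure (distr M borel (renewal_time X m)) {..t}"
  unfolding time_cdf_def by (subst measure_distr) (auto intro!: arg_cong[where f="measure M"])

lemma time_cdf_measurable[measurable]: "time_cdf m \<in> borel_measurable borel"
proof (rule borel_measurable_mono, rule monoI)
  show "time_cdf m x \<le> time_cdf m y" if "x \<le> y" for x y
    unfolding time_cdf_def using that by (intro finite_measure_mono) auto
qed

text \<open>Together with \<open>f_nonpos\<close> this later confines the convolution integral over
  the whole line to the interval from 0 to \<open>t\<close>.\<close>

lemma time_cdf_neg: "u < 0 \<Longrightarrow> time_cdf m u = 0"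
  unfolding time_cdf_def
proof (subst prob_eq_0)
  assume "u < 0"
  show "AE x in M. x \<notin> {\<omega> \<in> space M. renewal_time X m \<omega> \<le> u}"
    using AE_waiting_pos
  proof eventually_elim
    case (elim \<omega>)
    then show ?case
      using renewal_time_mono[OF elim, of 0 m] \<open>u < 0\<close> by auto
  qed
qed auto

lemma integrable_time_cdf: "integrable lborel (\<lambda>x. f x * time_cdf m (t - x))"
proof (rule Bochner_Integration.integrable_bound[OF f_integrable])
  show "AE x in lborel. norm (f x * time_cdf m (t - x)) \<le> norm (f x)"
    by (intro AE_I2) (auto simp: abs_mult time_cdf_def intro!: mult_right_le_one_le)
qed measurable

lemma time_cdf_Suc: "time_cdf (Suc m) t = (LINT x|lborel. f x * time_cdf m (t - x))"
proof -
  let ?D = "density lborel (\<lambda>x. ennreal (f x))" and ?T = "distr M borel (renewal_time X m)"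
  have Xm[measurable]: "X (Suc m) \<in> borel_measurable M"
    by (rule waiting_measurable) simp
  \<comment> \<open>The sum \<open>renewal_time X m\<close> involves only the indices 1 to
    \<open>m\<close>, so it is independent of the next waiting time.\<close>
  have iv: "indep_var borel (X (Suc m)) borel (renewal_time X m)"
    using indep_vars_sum[of "{1..m}" "Suc m" X] indep_vars_subset[OF indep, of "insert (Suc m) {1..m}"]
    by (auto simp: renewal_time_def[abs_def])
  have fin: "finite_measure ?D"
    using waiting_distr[of "Suc m"] prob_space_distr[OF Xm] by (simp add: prob_space.finite_measure)
  have eq: "distr M borel (renewal_time X (Suc m)) = convolution ?D ?T"
    using sum_indep_random_variable[OF iv] waiting_distr[of "Suc m"]
    by (simp add: renewal_time_Suc add.commute cong: distr_cong)
  have "emeasure (distr M borel (renewal_time X (Suc m))) {..t} = (\<integral>\<^sup>+x. emeasure ?T {a. a + x \<in> {..t}} \<partial>?D)"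
    unfolding eq
    by (rule convolution_emeasure)
      (auto intro!: fin prob_space.finite_measure prob_space_distr)
  also have "\<dots> = (\<integral>\<^sup>+x. ennreal (time_cdf m (t - x)) \<partial>?D)"
  proof (rule nn_integral_cong)
    fix x
    interpret T: prob_space ?T by (rule prob_space_distr) simp
    have "{a. a + x \<in> {..t}} = {..t - x}" by auto
    then show "emeasure ?T {a. a + x \<in> {..t}} = ennreal (time_cdf m (t - x))"
      by (simp add: time_cdf_eq T.emeasure_eq_measure)
  qed
  \<comment> \<open>As \<open>f\<close> is nonnegative only almost everywhere, the product is moved
    inside \<open>ennreal\<close> by an almost-everywhere congruence.\<close>
  also have "\<dots> = (\<integral>\<^sup>+x. ennreal (f x * time_cdf m (t - x)) \<partial>lborel)"
    by (subst nn_integral_density)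
      (use AE_f_nonneg in \<open>auto intro!: nn_integral_cong_AE elim!: eventually_mono simp: ennreal_mult' time_cdf_def\<close>)
  finally have "time_cdf (Suc m) t = enn2real (\<integral>\<^sup>+x. ennreal (f x * time_cdf m (t - x)) \<partial>lborel)"
    by (simp add: time_cdf_eq measure_def)
  then show ?thesis
    by (subst integral_eq_nn_integral)
      (use AE_f_nonneg in \<open>auto elim!: eventually_mono simp: time_cdf_def\<close>)
qed

section \<open>Almost sure finiteness of the number of renewals\<close>

lemma AE_finite_renewals: "AE \<omega> in M. finite {m. renewal_time X m \<omega> \<le> t}"
proof -
  define c where "c = expectation (\<lambda>\<omega>. exp (- X 1 \<omega>))"
  have int: "integrable M (\<lambda>\<omega>. exp (- X i \<omega>))" if "i \<ge> 1" for i
  proof (rule integrable_const_bound[where B=1])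
    show "AE \<omega> in M. norm (exp (- X i \<omega>)) \<le> 1"
      using AE_waiting_pos by eventually_elim (use that in \<open>auto simp: less_imp_le\<close>)
  qed (use waiting_measurable[OF that] in measurable)
  \<comment> \<open>By the common density, \<open>c\<close> is the Laplace transform of
    \<open>f\<close> at 1, whatever the index.\<close>
  have c: "expectation (\<lambda>\<omega>. exp (- X i \<omega>)) = c" if "i \<ge> 1" for i
  proof -
    have "expectation (\<lambda>\<omega>. exp (- X i \<omega>)) = (LINT x|density lborel (\<lambda>x. ennreal (f x)). exp (- x))"
      if "i \<ge> 1" for i
      using waiting_measurable[OF that]
      by (subst waiting_distr[OF that, symmetric], subst integral_distr) auto
    from this[OF that] this[of 1] show ?thesis by (simp add: c_def)
  qed
  have "c \<ge> 0" by (simp add: c_def)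
  \<comment> \<open>Strict, because the waiting time is almost surely positive and the integrand
    therefore almost surely below 1.\<close>
  have "c < 1"
    unfolding c_def
  proof (rule expectation_less[OF int])
    show "AE \<omega> in M. exp (- X 1 \<omega>) < 1"
      using AE_waiting_pos by eventually_elim auto
  qed simp
  have exp_eq: "exp (- renewal_time X m \<omega>) = (\<Prod>i\<in>{1..m}. exp (- X i \<omega>))" for m \<omega>
    by (simp add: renewal_time_def exp_sum flip: sum_negf)
  have ivexp: "indep_vars (\<lambda>_. borel) (\<lambda>i \<omega>. exp (- X i \<omega>)) {1..m}" for m
    using indep_vars_compose2[OF indep_vars_subset[OF indep, of "{1..m}"], of "\<lambda>_ x. exp (- x)" "\<lambda>_. borel"]
    by auto
  have chernoff: "time_cdf m t \<le> exp t * c ^ m" for m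
  proof -
    have "integrable M (\<lambda>\<omega>. exp (- renewal_time X m \<omega>))"
      unfolding exp_eq by (rule indep_vars_integrable[OF _ ivexp]) (auto intro: int)
    \<comment> \<open>Markov's inequality for \<open>exp (- T)\<close> with T the
      \<open>m\<close>-th renewal time: T is at most \<open>t\<close> exactly when
      \<open>exp (- T)\<close> is at least \<open>exp (- t)\<close>.\<close>
    then have "prob {\<omega> \<in> space M. exp (- t) \<le> exp (- renewal_time X m \<omega>)}
        \<le> expectation (\<lambda>\<omega>. exp (- renewal_time X m \<omega>)) / exp (- t)"
      by (intro integral_Markov_inequality_measure[where A="{}"]) auto
    also have "expectation (\<lambda>\<omega>. exp (- renewal_time X m \<omega>)) = c ^ m"
      unfolding exp_eq by (subst indep_vars_lebesgue_integral[OF _ ivexp]) (auto intro: int simp: c)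
    finally show ?thesis
      by (simp add: time_cdf_def exp_minus field_simps)
  qed
  \<comment> \<open>The event that no renewal time exceeds \<open>t\<close> lies in each event
    bounded by \<open>chernoff\<close>, and these bounds tend to 0.\<close>
  have "prob {\<omega> \<in> space M. \<forall>m. renewal_time X m \<omega> \<le> t} \<le> exp t * c ^ m" for m
    by (rule order_trans[OF _ chernoff]) (auto simp: time_cdf_def intro!: finite_measure_mono)
  moreover have "(\<lambda>m. exp t * c ^ m) \<longlonglongrightarrow> exp t * 0"
    using \<open>c \<ge> 0\<close> \<open>c < 1\<close> by (intro tendsto_mult_left LIMSEQ_realpow_zero)
  ultimately have "prob {\<omega> \<in> space M. \<forall>m. renewal_time X m \<omega> \<le> t} \<le> 0"
    using LIMSEQ_le_const[of "\<lambda>m. exp t * c ^ m" 0] by auto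
  then have "prob {\<omega> \<in> space M. \<forall>m. renewal_time X m \<omega> \<le> t} = 0"
    by (simp add: measure_le_0_iff)
  then have "AE \<omega> in M. \<omega> \<notin> {\<omega> \<in> space M. \<forall>m. renewal_time X m \<omega> \<le> t}"
    by (subst (asm) prob_eq_0) auto
  with AE_waiting_pos show ?thesis
    using AE_space
  proof eventually_elim
    case (elim \<omega>)
    then obtain n where n: "t < renewal_time X n \<omega>"
      by (auto simp: not_le)
    have "{m. renewal_time X m \<omega> \<le> t} \<subseteq> {..n}"
      using renewal_time_mono[OF elim(1), of n] n by (auto intro: leI) (meson leD le_trans linear order_trans)
    then show ?case
      by (rule finite_subset) simp
  qed
qed

section \<open>State probabilities as differences of distribution functions\<close>

lemma renewal_count_eq_iff:
  assumes pos: "\<forall>i\<ge>1. 0 < X i \<omega>" and fin: "finite {m. renewal_time X m \<omega> \<le> t}" and "t \<ge> 0"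
  shows "renewal_count X t \<omega> = k \<longleftrightarrow> renewal_time X k \<omega> \<le> t \<and> t < renewal_time X (Suc k) \<omega>"
proof -
  \<comment> \<open>Index 0 belongs to the set since \<open>t\<close> is nonnegative, so
    \<open>Max\<close> is a genuine maximum.\<close>
  have "{m. renewal_time X m \<omega> \<le> t} \<noteq> {}"
    using \<open>t \<ge> 0\<close> renewal_time_0 by (metis (mono_tags) empty_iff mem_Collect_eq)
  then have "renewal_count X t \<omega> = k \<longleftrightarrow>
      renewal_time X k \<omega> \<le> t \<and> (\<forall>m. renewal_time X m \<omega> \<le> t \<longrightarrow> m \<le> k)"
    unfolding renewal_count_def by (subst Max_eq_iff[OF fin]) simp_all
  \<comment> \<open>Renewal times increase, so if index \<open>Suc k\<close> is outside the set, all
    later ones are too.\<close>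
  also have "(\<forall>m. renewal_time X m \<omega> \<le> t \<longrightarrow> m \<le> k) \<longleftrightarrow> t < renewal_time X (Suc k) \<omega>"
  proof
    assume "t < renewal_time X (Suc k) \<omega>"
    then show "\<forall>m. renewal_time X m \<omega> \<le> t \<longrightarrow> m \<le> k"
      using renewal_time_mono[OF pos, of "Suc k"] by (meson not_less_eq_eq not_le order_trans)
  qed (use not_le Suc_n_not_le_n in blast)
  finally show ?thesis .
qed

text \<open>Measurability has to be checked also on the null set where \<^const>\<open>Max\<close> is applied to an
  infinite set: \<^const>\<open>measure\<close> is \<open>0\<close> on nonmeasurable sets.\<close>

lemma renewal_count_sets:
  assumes "t \<ge> 0"
  shows "{\<omega> \<in> space M. renewal_count X t \<omega> = k} \<in> events"
proof -
  let ?S = "\<lambda>\<omega>. {m. renewal_time X m \<omega> \<le> t}"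
  \<comment> \<open>Finiteness is rewritten as boundedness, leaving only quantifiers over naturals,
    which preserve measurability. \<open>the None\<close> is the value of \<open>Max\<close> on
    infinite sets.\<close>
  have "renewal_count X t \<omega> = k \<longleftrightarrow>
      (if \<exists>n. \<forall>m. renewal_time X m \<omega> \<le> t \<longrightarrow> m \<le> n
       then renewal_time X k \<omega> \<le> t \<and> (\<forall>m. renewal_time X m \<omega> \<le> t \<longrightarrow> m \<le> k)
       else k = the None)" for \<omega>
  proof (cases "finite (?S \<omega>)")
    case True
    moreover have "?S \<omega> \<noteq> {}"
      using assms renewal_time_0 by (metis (mono_tags) empty_iff mem_Collect_eq)
    ultimately have "renewal_count X t \<omega> = k \<longleftrightarrow> k \<in> ?S \<omega> \<and> (\<forall>m\<in>?S \<omega>. m \<le> k)"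
      unfolding renewal_count_def by (rule Max_eq_iff)
    moreover have "\<exists>n. \<forall>m. renewal_time X m \<omega> \<le> t \<longrightarrow> m \<le> n"
      using True by (simp add: finite_nat_set_iff_bounded_le)
    ultimately show ?thesis by simp
  next
    case False
    then show ?thesis
      by (auto simp: renewal_count_def Max.infinite finite_nat_set_iff_bounded_le)
  qed
  then show ?thesis by simp
qed

lemma state_prob_eq:
  assumes "t \<ge> 0"
  shows "state_prob M X k t = time_cdf k t - time_cdf (Suc k) t"
proof -
  let ?A = "\<lambda>m. {\<omega> \<in> space M. renewal_time X m \<omega> \<le> t}"
  have "state_prob M X k t = prob (?A k - ?A (Suc k))"
    unfolding state_prob_def
  proof (rule measure_eq_AE)
    show "AE \<omega> in M. \<omega> \<in> {\<omega> \<in> space M. renewal_count X t \<omega> = k} \<longleftrightarrow> \<omega> \<in> ?A k - ?A (Suc k)"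
      using AE_waiting_pos AE_finite_renewals[of t]
      by eventually_elim (use assms in \<open>auto simp: renewal_count_eq_iff\<close>)
  qed (use renewal_count_sets[OF assms] in auto)
  also have "\<dots> = prob (?A k) - prob (?A k \<inter> ?A (Suc k))"
    by (rule finite_measure_Diff') auto
  \<comment> \<open>The events are nested only almost surely, because the waiting times are positive
    only almost surely.\<close>
  also have "prob (?A k \<inter> ?A (Suc k)) = prob (?A (Suc k))"
  proof (rule measure_eq_AE)
    show "AE \<omega> in M. \<omega> \<in> ?A k \<inter> ?A (Suc k) \<longleftrightarrow> \<omega> \<in> ?A (Suc k)"
      using AE_waiting_pos
    proof eventually_elim
      case (elim \<omega>)
      then show ?case using renewal_time_mono[OF elim, of k "Suc k"] by auto
    qed
  qed auto
  finally show ?thesis by (simp add: time_cdf_def)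
qed

section \<open>The renewal equation and its Mittag-Leffler instance\<close>

proposition renewal_equation:
  assumes "t \<ge> 0"
  shows "set_integrable lborel {0..t} (\<lambda>w. f (t - w) * state_prob M X k w)"
    and "state_prob M X (Suc k) t = (LINT w:{0..t}|lborel. f (t - w) * state_prob M X k w)"
proof -
  let ?p = "\<lambda>w. time_cdf k w - time_cdf (Suc k) w"
  let ?g = "\<lambda>x. f x * ?p (t - x)"
  have g: "integrable lborel ?g"
    using Bochner_Integration.integrable_diff[OF integrable_time_cdf[of k t] integrable_time_cdf[of "Suc k" t]]
    by (simp add: right_diff_distrib)
  \<comment> \<open>Outside the interval both sides vanish: for \<open>w < 0\<close> both
    distribution functions are 0, for \<open>w > t\<close> the density is. Inside,
    \<open>state_prob_eq\<close> applies. The form \<open>t + (-1) * w\<close> fits the affine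
    change of variables, whose Jacobian factor is 1.\<close>
  have eq: "indicator {0..t} w *\<^sub>R (f (t - w) * state_prob M X k w) = ?g (t + (-1) * w)" for w
    by (cases "w < 0 \<or> w > t") (auto simp: state_prob_eq time_cdf_neg f_nonpos)
  show "set_integrable lborel {0..t} (\<lambda>w. f (t - w) * state_prob M X k w)"
    unfolding set_integrable_def eq using lborel_integrable_real_affine[OF g, of "-1" t] by simp
  have "state_prob M X (Suc k) t = (LINT x|lborel. ?g x)"
    using Bochner_Integration.integral_diff[OF integrable_time_cdf[of k t] integrable_time_cdf[of "Suc k" t]]
    by (simp add: state_prob_eq[OF assms] time_cdf_Suc[of _ t] right_diff_distrib)
  also have "\<dots> = (LINT w|lborel. ?g (t + (-1) * w))"
    using lborel_integral_real_affine[of "-1" ?g t] by simp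
  finally show "state_prob M X (Suc k) t = (LINT w:{0..t}|lborel. f (t - w) * state_prob M X k w)"
    unfolding set_lebesgue_integral_def eq .
qed

end

theorem theorem2p1:
  fixes M :: "'b measure" and X :: "nat \<Rightarrow> 'b \<Rightarrow> real"
    and lam \<nu> \<delta> t :: real and k :: nat
  assumes "prob_space M"
    and "lam > 0" and "0 < \<nu>" and "\<nu> \<le> 1" and "\<delta> > 0"
    and "prob_space.indep_vars M (\<lambda>_. borel) X {1..}"
    and "\<And>i. i \<ge> 1 \<Longrightarrow> has_density M (X i) (gml_density lam \<nu> \<delta>)"
    and "k \<ge> 1" and "t \<ge> 0"
  shows "set_integrable lborel {0..t}
           (\<lambda>w. (t - w) powr (\<nu> * \<delta> - 1) * mittag_leffler3 \<nu> (\<nu> * \<delta>) \<delta> (- lam * (t - w) powr \<nu>)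
                * state_prob M X (k - 1) w)
         \<and> state_prob M X k t =
           lam powr \<delta> *
           (LINT w:{0..t}|lborel.
              (t - w) powr (\<nu> * \<delta> - 1) * mittag_leffler3 \<nu> (\<nu> * \<delta>) \<delta> (- lam * (t - w) powr \<nu>)
              * state_prob M X (k - 1) w)"
proof -
  interpret prob_space M by fact
  interpret renewal_process M X "gml_density lam \<nu> \<delta>"
    using assms by unfold_locales (auto simp: gml_density_def)
  let ?h = "\<lambda>w. (t - w) powr (\<nu> * \<delta> - 1) * mittag_leffler3 \<nu> (\<nu> * \<delta>) \<delta> (- lam * (t - w) powr \<nu>)
                * state_prob M X (k - 1) w"
  \<comment> \<open>At \<open>w = t\<close> both sides are 0: the density by its case distinction,
    the kernel because \<open>0 powr a = 0\<close> for every exponent.\<close>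
  have eq: "indicator {0..t} w *\<^sub>R (gml_density lam \<nu> \<delta> (t - w) * state_prob M X (k - 1) w)
      = lam powr \<delta> * (indicator {0..t} w *\<^sub>R ?h w)" for w
    by (cases "w = t") (auto simp: gml_density_def mult_ac split: split_indicator)
  have "integrable lborel (\<lambda>w. lam powr \<delta> * (indicator {0..t} w *\<^sub>R ?h w))"
    using renewal_equation(1)[OF \<open>t \<ge> 0\<close>, of "k - 1"] unfolding set_integrable_def eq .
  \<comment> \<open>The constant \<open>lam powr \<delta>\<close> is nonzero and can be
    cancelled.\<close>
  then have "set_integrable lborel {0..t} ?h"
    using \<open>lam > 0\<close> by (simp add: set_integrable_def)
  moreover have "state_prob M X k t = lam powr \<delta> * (LINT w:{0..t}|lborel. ?h w)"
    using renewal_equation(2)[OF \<open>t \<ge> 0\<close>, of "k - 1"] \<open>k \<ge> 1\<close>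
    unfolding set_lebesgue_integral_def eq by simp
  ultimately show ?thesis by blast
qed

end
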